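(* Let $n,m\ge 1$, let $\mathcal{A}:\mathcal{H}^n\to\mathbb{R}^m$ be a (real-)linear map, $b\in\mathbb{R}^m$, let $\|\cdot\|$ be a norm on $\mathbb{R}^m$ with dual norm $\|\cdot\|_*$, and let $0\le\epsilon<\|b\|$. Suppose that there exists $X\in\mathcal{H}^n$ with $X\succeq 0$ and $\|b-\mathcal{A}X\|\le\epsilon$. Let $y\in\mathbb{R}^m$ be an arbitrary optimal solution of the gauge dual problem $$\text{minimize}_{y\in\mathbb{R}^m}\ [\lambda_1(\mathcal{A}^*y)]_+\quad\text{subject to}\quad \langle b,y\rangle-\epsilon\|y\|_*\ge 1 .$$ Let $r_1\in\{1,\dots,n\}$ be the multiplicity of the eigenvalue $\lambda_1(\mathcal{A}^*y)$, and let $U_1\in\mathbb{C}^{n\times r_1}$ be the matrix whose columns are the first $r_1$ (orthonormal) eigenvectors of $\mathcal{A}^*y$, i.e. an orthonormal basis of the eigenspace for $\lambda_1(\mathcal{A}^*y)$. Then a matrix $X\in\mathcal{H}^n$ is a solution of the primal problem $$\text{minimize}_{X\in\mathcal{H}^n}\ \operatorname{trace}X+\delta(X\mid\cdot\succeq 0)\quad\text{subject to}\quad\|b-\mathcal{A}X\|\le\epsilon$$ if and only if there exists an $r_1\times r_1$ matrix $S\succeq 0$ such that $$X=U_1SU_1^*\quad\text{and}\quad (b-\mathcal{A}X)\in\epsilon\,\partial\|\cdot\|_*(y).$$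
   Context: $\mathcal{H}^n$ is the real vector space of $n\times n$ complex Hermitian matrices with inner product $\langle X,Y\rangle=\operatorname{trace}(XY^* )$, where $Y^*$ is the conjugate transpose; $\mathbb{R}^m$ carries the standard inner product, and $\mathcal{A}^*:\mathbb{R}^m\to\mathcal{H}^n$ is the adjoint of $\mathcal{A}$. $X\succeq0$ means that $X$ is Hermitian positive semidefinite. $\delta(X\mid\cdot\succeq0)$ equals $0$ if $X\succeq 0$ and $+\infty$ otherwise. For Hermitian $A$, $\lambda_1(A)\ge\cdots\ge\lambda_n(A)$ are its ordered eigenvalues. $[t]_+=\max\{0,t\}$. The dual norm is $\|y\|_*=\sup_{\|z\|\le1}\langle z,y\rangle$, and $\partial\|\cdot\|_*(y)$ is the convex subdifferential of $\|\cdot\|_*$ at $y$; $\epsilon\,\partial\|\cdot\|_*(y)=\{\epsilon z: z\in\partial\|\cdot\|_*(y)\}$. *)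

theory Defs
  imports "HOL-Analysis.Analysis"
begin

definition ctranspose :: "complex^'n^'m \<Rightarrow> complex^'m^'n" where
  "ctranspose M = (\<chi> i j. cnj (M $ j $ i))"

definition hermitian :: "complex^'n^'n \<Rightarrow> bool" where
  "hermitian M \<longleftrightarrow> ctranspose M = M"

definition cdot :: "complex^'n \<Rightarrow> complex^'n \<Rightarrow> complex" where
  "cdot u v = (\<Sum>i\<in>UNIV. cnj (u $ i) * v $ i)"

text \<open>The form \<open>cdot v (M *v v)\<close> is real for Hermitian \<open>M\<close>, so taking its real part loses nothing.\<close>
definition psd :: "complex^'n^'n \<Rightarrow> bool" where
  "psd M \<longleftrightarrow> hermitian M \<and> (\<forall>v. 0 \<le> Re (cdot v (M *v v)))"

definition eigenspace :: "complex^'n^'n \<Rightarrow> complex \<Rightarrow> (complex^'n) set" where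
  "eigenspace M c = {v. M *v v = c *s v}"

text \<open>Only used for Hermitian \<open>M\<close>, all of whose eigenvalues are real.\<close>
definition real_eigenvalues :: "complex^'n^'n \<Rightarrow> real set" where
  "real_eigenvalues M = {c. \<exists>v. v \<noteq> 0 \<and> v \<in> eigenspace M (complex_of_real c)}"

definition lambda1 :: "complex^'n^'n \<Rightarrow> real" where
  "lambda1 M = Max (real_eigenvalues M)"

text \<open>For Hermitian \<open>M\<close>, geometric and algebraic multiplicities coincide.\<close>
definition eig_multiplicity :: "complex^'n^'n \<Rightarrow> real \<Rightarrow> nat" where
  "eig_multiplicity M c = vec.dim (eigenspace M (complex_of_real c))"

text \<open>The columns of \<open>U\<close>, indexed by \<open>'r\<close>, form an orthonormal basis of the subspace \<open>E\<close>.\<close>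
definition orthonormal_basis_of :: "complex^'r^'n \<Rightarrow> (complex^'n) set \<Rightarrow> bool" where
  "orthonormal_basis_of U E \<longleftrightarrow>
     (\<forall>i j. cdot (column i U) (column j U) = (if i = j then 1 else 0)) \<and>
     vec.span (columns U) = E"


subsection \<open>The Euclidean space of Hermitian matrices\<close>

text \<open>A separate type, so that the library notions \<^const>\<open>linear\<close> and \<^const>\<open>adjoint\<close>
  refer to the real vector space of Hermitian matrices and its trace inner product.\<close>

typedef 'n herm = "{M :: complex^'n^'n. hermitian M}"
  morphisms mat_of Herm
  by (rule exI[of _ 0]) (simp add: hermitian_def ctranspose_def vec_eq_iff)

setup_lifting type_definition_herm

text \<open>The trace of \<open>X Y\<^sup>*\<close> is real for Hermitian \<open>X\<close>, \<open>Y\<close>; see \<open>trace_inner_real\<close> below.\<close>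

definition trace_inner :: "complex^'n^'n \<Rightarrow> complex^'n^'n \<Rightarrow> real" where
  "trace_inner X Y = Re (trace (X ** ctranspose Y))"

lemma trace_inner_real:
  assumes "hermitian X" "hermitian Y"
  shows "trace (X ** ctranspose Y) \<in> \<real>"
proof -
  have X: "cnj (X $ i $ j) = X $ j $ i" and Y: "cnj (Y $ i $ j) = Y $ j $ i" for i j
    using assms by (auto simp: hermitian_def ctranspose_def vec_eq_iff)
  have "cnj (trace (X ** ctranspose Y)) = (\<Sum>i\<in>UNIV. \<Sum>j\<in>UNIV. X $ j $ i * Y $ i $ j)"
    by (simp add: trace_def matrix_matrix_mult_def ctranspose_def X)
  also have "\<dots> = trace (X ** ctranspose Y)"
    by (subst sum.swap) (simp add: trace_def matrix_matrix_mult_def ctranspose_def Y)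
  finally show ?thesis
    by (simp add: Reals_cnj_iff)
qed

lemma trace_inner_eq_inner: "trace_inner X Y = X \<bullet> Y"
  by (simp add: trace_inner_def trace_def matrix_matrix_mult_def ctranspose_def inner_vec_def
      inner_complex_def)

instantiation herm :: (finite) real_inner
begin

lift_definition zero_herm :: "'a herm" is 0
  by (simp add: hermitian_def ctranspose_def vec_eq_iff)

lift_definition plus_herm :: "'a herm \<Rightarrow> 'a herm \<Rightarrow> 'a herm" is "(+)"
  by (simp add: hermitian_def ctranspose_def vec_eq_iff)

lift_definition minus_herm :: "'a herm \<Rightarrow> 'a herm \<Rightarrow> 'a herm" is "(-)"
  by (simp add: hermitian_def ctranspose_def vec_eq_iff)

lift_definition uminus_herm :: "'a herm \<Rightarrow> 'a herm" is uminus
  by (simp add: hermitian_def ctranspose_def vec_eq_iff)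

lift_definition scaleR_herm :: "real \<Rightarrow> 'a herm \<Rightarrow> 'a herm" is "(*\<^sub>R)"
  by (simp add: hermitian_def ctranspose_def vec_eq_iff)

lift_definition inner_herm :: "'a herm \<Rightarrow> 'a herm \<Rightarrow> real" is trace_inner .

definition norm_herm :: "'a herm \<Rightarrow> real" where
  "norm_herm X = sqrt (X \<bullet> X)"

definition sgn_herm :: "'a herm \<Rightarrow> 'a herm" where
  "sgn_herm X = inverse (norm X) *\<^sub>R X"

definition dist_herm :: "'a herm \<Rightarrow> 'a herm \<Rightarrow> real" where
  "dist_herm X Y = norm (X - Y)"

definition uniformity_herm :: "('a herm \<times> 'a herm) filter" where
  "uniformity_herm = (INF e\<in>{0 <..}. principal {(x, y). dist x y < e})"

definition open_herm :: "'a herm set \<Rightarrow> bool" where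
  "open_herm S = (\<forall>x\<in>S. \<forall>\<^sub>F (x', y) in uniformity. x' = x \<longrightarrow> y \<in> S)"

instance
proof
  fix X Y Z :: "'a herm" and c d :: real and S :: "'a herm set"
  show "X + Y + Z = X + (Y + Z)" by transfer (simp add: algebra_simps)
  show "X + Y = Y + X" by transfer (simp add: algebra_simps)
  show "0 + X = X" by transfer simp
  show "- X + X = 0" by transfer simp
  show "X - Y = X + - Y" by transfer simp
  show "c *\<^sub>R (X + Y) = c *\<^sub>R X + c *\<^sub>R Y" by transfer (rule scaleR_add_right)
  show "(c + d) *\<^sub>R X = c *\<^sub>R X + d *\<^sub>R X" by transfer (rule scaleR_add_left)
  show "c *\<^sub>R d *\<^sub>R X = (c * d) *\<^sub>R X" by transfer simp
  show "1 *\<^sub>R X = X" by transfer simp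
  show "sgn X = inverse (norm X) *\<^sub>R X" by (simp add: sgn_herm_def)
  show "dist X Y = norm (X - Y)" by (rule dist_herm_def)
  show "uniformity = (INF e\<in>{0 <..}. principal {(x, y :: 'a herm). dist x y < e})"
    by (rule uniformity_herm_def)
  show "open S \<longleftrightarrow> (\<forall>x\<in>S. \<forall>\<^sub>F (x', y) in uniformity. x' = x \<longrightarrow> y \<in> S)"
    by (rule open_herm_def)
  show "X \<bullet> Y = Y \<bullet> X" by transfer (simp add: trace_inner_eq_inner inner_commute)
  show "(X + Y) \<bullet> Z = X \<bullet> Z + Y \<bullet> Z" by transfer (simp add: trace_inner_eq_inner inner_add_left)
  show "(c *\<^sub>R X) \<bullet> Y = c * (X \<bullet> Y)" by transfer (simp add: trace_inner_eq_inner)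
  show "0 \<le> X \<bullet> X" by transfer (simp add: trace_inner_eq_inner)
  show "X \<bullet> X = 0 \<longleftrightarrow> X = 0" by transfer (simp add: trace_inner_eq_inner)
  show "norm X = sqrt (X \<bullet> X)" by (rule norm_herm_def)
qed

end

lemma herm_orthonormal_basis:
  "\<exists>B :: 'a::finite herm set. B \<noteq> {} \<and> finite B \<and>
     (\<forall>u\<in>B. \<forall>v\<in>B. u \<bullet> v = (if u = v then 1 else 0)) \<and>
     (\<forall>x. (\<forall>u\<in>B. x \<bullet> u = 0) \<longleftrightarrow> x = 0)"
proof -
  let ?H = "{M :: complex^'a^'a. hermitian M}"
  have sub: "subspace ?H"
    by (auto simp: subspace_def hermitian_def ctranspose_def vec_eq_iff)
  obtain C where C: "C \<subseteq> ?H" "pairwise orthogonal C" "\<And>x. x \<in> C \<Longrightarrow> norm x = 1"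
      "independent C" "card C = dim ?H" "span C = ?H"
    using orthonormal_basis_subspace[OF sub] by metis
  define B where "B = Herm ` C"
  have mat: "mat_of (Herm c) = c" if "c \<in> C" for c
    using that C(1) by (auto intro: Herm_inverse)
  have inn: "x \<bullet> Herm c = mat_of x \<bullet> c" if "c \<in> C" for x c
    using that by (simp add: inner_herm.rep_eq trace_inner_eq_inner mat)
  have "finite B"
    using C(4) by (simp add: B_def independent_imp_finite)
  moreover have "u \<bullet> v = (if u = v then 1 else 0)" if "u \<in> B" "v \<in> B" for u v
  proof -
    from that obtain c d where cd: "c \<in> C" "d \<in> C" "u = Herm c" "v = Herm d"
      by (auto simp: B_def)
    have "c = d \<longleftrightarrow> u = v"
      using cd mat by metis
    moreover have "c \<bullet> c = 1"
      using C(3) cd by (simp add: dot_square_norm)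
    moreover have "c \<bullet> d = 0" if "c \<noteq> d"
      using C(2) cd that by (auto simp: pairwise_def orthogonal_def)
    ultimately show ?thesis
      using cd by (auto simp: inn mat)
  qed
  moreover have zero: "(\<forall>u\<in>B. x \<bullet> u = 0) \<longleftrightarrow> x = 0" for x :: "'a herm"
  proof
    assume "\<forall>u\<in>B. x \<bullet> u = 0"
    then have "orthogonal (mat_of x) c" if "c \<in> C" for c
      using that by (auto simp: B_def inn orthogonal_def)
    moreover have "mat_of x \<in> span C"
      using mat_of[of x] by (simp add: C(6))
    ultimately have "orthogonal (mat_of x) (mat_of x)"
      by (blast intro: orthogonal_to_span)
    then show "x = 0"
      by (simp add: orthogonal_def flip: mat_of_inject zero_herm.rep_eq)
  qed simp
  moreover have "B \<noteq> {}"
  proof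
    assume "B = {}"
    then have "Herm (mat 1) = (0 :: 'a herm)"
      using zero by blast
    moreover have "hermitian (mat 1 :: complex^'a^'a)"
      by (auto simp: hermitian_def ctranspose_def mat_def vec_eq_iff)
    ultimately have "(mat 1 :: complex^'a^'a) = 0"
      by (metis Herm_inverse mem_Collect_eq zero_herm.rep_eq)
    then have "(mat 1 :: complex^'a^'a) $ i $ i = 0" for i
      by simp
    then show False
      by (simp add: mat_def)
  qed
  ultimately show ?thesis
    by blast
qed

instantiation herm :: (finite) euclidean_space
begin

definition Basis_herm :: "'a herm set" where
  "Basis_herm = (SOME B. B \<noteq> {} \<and> finite B \<and>
     (\<forall>u\<in>B. \<forall>v\<in>B. u \<bullet> v = (if u = v then 1 else 0)) \<and>
     (\<forall>x. (\<forall>u\<in>B. x \<bullet> u = 0) \<longleftrightarrow> x = 0))"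

instance
proof
  have B: "(Basis :: 'a herm set) \<noteq> {} \<and> finite (Basis :: 'a herm set) \<and>
     (\<forall>u\<in>Basis. \<forall>v\<in>Basis. (u :: 'a herm) \<bullet> v = (if u = v then 1 else 0)) \<and>
     (\<forall>x :: 'a herm. (\<forall>u\<in>Basis. x \<bullet> u = 0) \<longleftrightarrow> x = 0)"
    unfolding Basis_herm_def by (rule someI_ex[OF herm_orthonormal_basis])
  show "(Basis :: 'a herm set) \<noteq> {}" "finite (Basis :: 'a herm set)"
    using B by simp_all
  show "u \<bullet> v = (if u = v then 1 else 0)" if "u \<in> Basis" "v \<in> Basis" for u v :: "'a herm"
    using B that by simp
  show "(\<forall>u\<in>Basis. x \<bullet> u = 0) \<longleftrightarrow> x = 0" for x :: "'a herm"
    using B by simp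
qed

end

text \<open>The diagonal of a Hermitian matrix is real.\<close>
definition herm_trace :: "'n::finite herm \<Rightarrow> real" where
  "herm_trace X = Re (trace (mat_of X))"

definition psd_indicator :: "'n::finite herm \<Rightarrow> ereal" where
  "psd_indicator X = (if psd (mat_of X) then 0 else \<infinity>)"


subsection \<open>Norms, dual norms, subdifferentials\<close>

definition is_norm :: "('a::real_vector \<Rightarrow> real) \<Rightarrow> bool" where
  "is_norm N \<longleftrightarrow>
     (\<forall>x. N x = 0 \<longleftrightarrow> x = 0) \<and>
     (\<forall>x y. N (x + y) \<le> N x + N y) \<and>
     (\<forall>c x. N (c *\<^sub>R x) = \<bar>c\<bar> * N x)"

text \<open>In finite dimension the supremum is over a bounded set, so the real-valued \<open>Sup\<close> is the true one.\<close>
definition dual_norm :: "('a::euclidean_space \<Rightarrow> real) \<Rightarrow> 'a \<Rightarrow> real" where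
  "dual_norm N y = (SUP z\<in>{z. N z \<le> 1}. z \<bullet> y)"

definition subdifferential :: "('a::real_inner \<Rightarrow> real) \<Rightarrow> 'a \<Rightarrow> 'a set" where
  "subdifferential f y = {z. \<forall>w. f w \<ge> f y + z \<bullet> (w - y)}"

end

(* For primal feasible X and dual feasible y one has
     1 <= <b,y> - eps |y|_* <= <b,y> - <b - A X, y> = <X, A* y> <= lambda_1(A* y) tr X,
   and if y is optimal and X is optimal then lambda_1(A* y) tr X <= 1: for p < tr X, separating b
   from the compact convex set {A X + z : X psd, tr X <= p, |z| <= eps} gives a dual feasible point
   of value below 1/p.  So X is optimal iff the chain collapses.  Its last step is tight iff
   <X, lambda_1 I - A* y> = 0; writing X as a sum of terms v v*, this says that every v lies in the
   eigenspace, i.e. X = U1 S U1*.  The other step is tight iff <b - A X, y> = eps |y|_*, which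
   together with |b - A X| <= eps is the subdifferential condition. *)

theory Submission
  imports Defs
begin

subsection \<open>Rank-one Hermitian matrices\<close>

lemma Re_cdot: "Re (cdot u v) = u \<bullet> v"
  by (simp add: cdot_def inner_vec_def inner_complex_def)

lemma inner_herm_mat: "X \<bullet> Y = mat_of X \<bullet> mat_of Y"
  by (simp add: inner_herm.rep_eq trace_inner_eq_inner)

lemma hermitian_mat_of: "hermitian (mat_of X)"
  using mat_of[of X] by simp

lemma mat_of_nth_cnj: "cnj (mat_of X $ i $ j) = mat_of X $ j $ i"
  using hermitian_mat_of[of X] by (auto simp: hermitian_def ctranspose_def vec_eq_iff)

text \<open>Conjugation does not change a real part. For Hermitian \<open>M\<close> it turns the
  term with indices j, i of the double sum into the term with indices i, j and with
  \<open>u\<close>, \<open>v\<close> exchanged.\<close>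

lemma hermitian_symmetric:
  assumes "hermitian M"
  shows "u \<bullet> (M *v v) = v \<bullet> (M *v u)"
proof -
  have M: "M $ i $ j = cnj (M $ j $ i)" for i j
    using assms by (auto simp: hermitian_def ctranspose_def vec_eq_iff)
  have "u \<bullet> (M *v v) = (\<Sum>i\<in>UNIV. \<Sum>j\<in>UNIV. Re (cnj (u $ i) * M $ i $ j * v $ j))"
    unfolding Re_cdot[symmetric] cdot_def
    by (simp add: matrix_vector_mult_def sum_distrib_left mult.assoc)
  also have "\<dots> = (\<Sum>i\<in>UNIV. \<Sum>j\<in>UNIV. Re (cnj (v $ i) * M $ i $ j * u $ j))"
  proof (subst sum.swap, intro sum.cong refl)
    fix i j
    have "Re (cnj (u $ j) * M $ j $ i * v $ i) = Re (cnj (cnj (u $ j) * M $ j $ i * v $ i))"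
      by (simp only: complex_cnj cnj.sel)
    also have "cnj (cnj (u $ j) * M $ j $ i * v $ i) = cnj (v $ i) * M $ i $ j * u $ j"
      using M[of i j] by simp
    finally show "Re (cnj (u $ j) * M $ j $ i * v $ i) = Re (cnj (v $ i) * M $ i $ j * u $ j)" .
  qed
  also have "\<dots> = v \<bullet> (M *v u)"
    unfolding Re_cdot[symmetric] cdot_def
    by (simp add: matrix_vector_mult_def sum_distrib_left mult.assoc)
  finally show ?thesis .
qed

definition outer :: "complex^'n \<Rightarrow> 'n::finite herm" where
  "outer v = Herm (\<chi> i j. v $ i * cnj (v $ j))"

lemma mat_of_outer: "mat_of (outer v) = (\<chi> i j. v $ i * cnj (v $ j))"
  unfolding outer_def by (rule Herm_inverse) (simp add: hermitian_def ctranspose_def vec_eq_iff mult.commute)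

text \<open>Turns the quadratic form of \<open>X\<close> into a linear functional of
  \<open>X\<close>, so that positivity and Rayleigh quotients become statements about inner products
  in \<open>herm\<close>.\<close>

lemma inner_outer: "X \<bullet> outer v = v \<bullet> (mat_of X *v v)"
  unfolding inner_herm_mat mat_of_outer Re_cdot[symmetric] cdot_def
  by (simp add: matrix_vector_mult_def sum_distrib_left inner_vec_def inner_complex_def)
     (intro sum.cong refl, simp add: algebra_simps)

lemma psd_iff: "psd (mat_of X) \<longleftrightarrow> (\<forall>v. 0 \<le> X \<bullet> outer v)"
  by (simp add: psd_def hermitian_mat_of Re_cdot inner_outer)

definition id_herm :: "'n::finite herm" where
  "id_herm = Herm (mat 1)"

lemma mat_of_id_herm: "mat_of id_herm = mat 1"
  unfolding id_herm_def
  by (rule Herm_inverse) (auto simp: hermitian_def ctranspose_def mat_def vec_eq_iff)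

lemma herm_trace_eq: "herm_trace X = X \<bullet> id_herm"
  by (simp add: herm_trace_def inner_herm_mat mat_of_id_herm trace_inner_eq_inner[symmetric]
      trace_inner_def)
     (simp add: ctranspose_def mat_def trace_def matrix_matrix_mult_def if_distrib cong: if_cong)

lemma trace_outer: "outer v \<bullet> id_herm = v \<bullet> v"
  by (simp add: inner_commute[of _ id_herm] inner_outer mat_of_id_herm)

text \<open>The vector \<open>v\<close> is an eigenvector of v v* with eigenvalue
  \<open>v \<bullet> v\<close>. On rank-one matrices the norm thus agrees with the trace.\<close>

lemma norm_outer: "norm (outer v) = v \<bullet> v"
proof -
  have "mat_of (outer v) *v v = (v \<bullet> v) *\<^sub>R v"
  proof (rule vec_eq_iff[THEN iffD2], rule allI)
    fix i
    have c: "(\<Sum>j\<in>UNIV. cnj (v $ j) * v $ j) = complex_of_real (v \<bullet> v)"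
      by (simp add: inner_vec_def mult.commute[of "cnj _"] complex_mult_cnj cmod_power2[symmetric]
          inner_complex_def power2_eq_square[symmetric])
    have "(mat_of (outer v) *v v) $ i = v $ i * (\<Sum>j\<in>UNIV. cnj (v $ j) * v $ j)"
      by (simp add: mat_of_outer matrix_vector_mult_def sum_distrib_left mult.assoc)
    then show "(mat_of (outer v) *v v) $ i = ((v \<bullet> v) *\<^sub>R v) $ i"
      unfolding c by (simp add: scaleR_conv_of_real[where 'a=complex] mult.commute)
  qed
  then have "outer v \<bullet> outer v = (v \<bullet> v)\<^sup>2"
    by (simp add: inner_outer power2_eq_square)
  then show ?thesis
    by (simp add: norm_eq_sqrt_inner)
qed

text \<open>Moving from \<open>v\<close> by \<open>t\<close> in the direction \<open>M *v v\<close>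
  changes the form to a quadratic polynomial in \<open>t\<close> without constant term. It stays
  nonnegative only if its linear coefficient, twice the squared length of \<open>M *v v\<close>,
  vanishes.\<close>

lemma psd_kernel:
  assumes "psd M" "v \<bullet> (M *v v) = 0"
  shows "M *v v = 0"
proof -
  let ?w = "M *v v"
  define q where "q = ?w \<bullet> (M *v ?w)"
  have "0 \<le> 2 * t * (?w \<bullet> ?w) + t\<^sup>2 * q" for t
  proof -
    have "0 \<le> (v + t *\<^sub>R ?w) \<bullet> (M *v (v + t *\<^sub>R ?w))"
      using assms(1) by (simp add: psd_def Re_cdot)
    also have "\<dots> = v \<bullet> ?w + t * (v \<bullet> (M *v ?w)) + t * (?w \<bullet> ?w) + t\<^sup>2 * q"
      by (simp add: matrix_vector_right_distrib linear_cmul[OF matrix_vector_mul_linear]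
         q_def power2_eq_square algebra_simps)
    also have "v \<bullet> (M *v ?w) = ?w \<bullet> ?w"
      using assms(1) by (simp add: psd_def hermitian_symmetric[of M v])
    finally show ?thesis
      using assms(2) by simp
  qed
  note t = this
  define a where "a = ?w \<bullet> ?w"
  have q: "0 \<le> q"
    using assms(1) by (simp add: psd_def Re_cdot q_def)
  \<comment> \<open>The choice t = -a/(q+1) makes the polynomial negative unless a = 0; the shift by
    1 covers q = 0.\<close>
  have "0 \<le> (q + 1)\<^sup>2 * (2 * (- a / (q + 1)) * a + (- a / (q + 1))\<^sup>2 * q)"
    using t[of "- a / (q + 1)"] by (simp add: a_def)
  also have "\<dots> = - ((q + 2) * a\<^sup>2)"
  proof -
    have "s\<^sup>2 * (2 * (- a / s) * a + (- a / s)\<^sup>2 * q) = - ((2 * s - q) * a\<^sup>2)" if "s \<noteq> 0" for s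
      using that by (simp add: field_simps power2_eq_square)
    from this[of "q + 1"] q show ?thesis by simp
  qed
  finally have "(q + 2) * a\<^sup>2 \<le> 0" by simp
  then have "a = 0"
    using q by (simp add: mult_le_0_iff)
  then have "?w \<bullet> ?w = 0" by (simp add: a_def)
  then show ?thesis by simp
qed

subsection \<open>Decomposition of positive semidefinite matrices\<close>

lemma matrix_vector_axis: "(M *v axis i c) $ j = M $ j $ i * (c::complex)"
  by (simp add: matrix_vector_mult_def axis_def if_distrib cong: if_cong)

lemma psd_diag:
  assumes "psd M"
  shows "M $ i $ i = complex_of_real (Re (M $ i $ i))" "0 \<le> Re (M $ i $ i)"
proof -
  have "cnj (M $ i $ i) = M $ i $ i"
    using assms by (auto simp: psd_def hermitian_def ctranspose_def vec_eq_iff)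
  then show "M $ i $ i = complex_of_real (Re (M $ i $ i))"
    by (simp add: complex_eq_iff)
  have "0 \<le> axis i 1 \<bullet> (M *v axis i 1)"
    using assms by (simp add: psd_def Re_cdot)
  then show "0 \<le> Re (M $ i $ i)"
    by (simp add: inner_axis' matrix_vector_axis inner_complex_def)
qed

text \<open>A diagonal entry is the form at a unit coordinate vector. If it is zero, that vector
  lies in the kernel, and its image is the whole column.\<close>

lemma psd_zero_diag:
  assumes "psd M" "M $ i $ i = 0"
  shows "M $ j $ i = 0"
proof -
  have "M *v axis i 1 = 0"
    using assms by (intro psd_kernel) (simp_all add: inner_axis' matrix_vector_axis)
  then have "(M *v axis i 1) $ j = 0"
    by simp
  then show ?thesis
    by (simp add: matrix_vector_axis)
qed

lemma inner_outer_outer: "outer w \<bullet> outer v = (cmod (cdot w v))\<^sup>2"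
proof -
  have "mat_of (outer w) *v v = cdot w v *s w"
    by (simp add: vec_eq_iff mat_of_outer matrix_vector_mult_def cdot_def sum_distrib_left ac_simps)
  then have "outer w \<bullet> outer v = Re (cdot v (cdot w v *s w))"
    by (simp add: inner_outer Re_cdot)
  also have "cdot v (cdot w v *s w) = cdot w v * cnj (cdot w v)"
    by (simp add: cdot_def sum_distrib_left ac_simps)
  also have "Re \<dots> = (cmod (cdot w v))\<^sup>2"
    by (simp add: complex_mult_cnj cmod_power2)
  finally show ?thesis .
qed

text \<open>One step of Cholesky elimination with pivot \<open>i\<close>: \<open>Y\<close> is
  \<open>X\<close> minus the rank-one matrix built from column \<open>i\<close>, and positivity of
  \<open>Y\<close> is the Schur complement argument.\<close>

lemma psd_cholesky_step:
  fixes X :: "'n::finite herm"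
  assumes psd: "psd (mat_of X)" and nz: "mat_of X $ i $ i \<noteq> 0"
  obtains Y w where "X = Y + outer w" "psd (mat_of Y)"
    "{j. mat_of Y $ j $ j \<noteq> 0} \<subset> {j. mat_of X $ j $ j \<noteq> 0}"
proof -
  define M where "M = mat_of X"
  define d where "d = Re (M $ i $ i)"
  have Mii: "M $ i $ i = complex_of_real d" and "0 \<le> d"
    using psd_diag[OF psd] by (simp_all add: M_def d_def)
  then have d: "0 < d"
    using nz by (auto simp: M_def less_le)
  define w where "w = (1 / sqrt d) *\<^sub>R column i M"
  define Y where "Y = X - outer w"
  have w_nth: "w $ j = M $ j $ i / sqrt d" for j
    by (simp add: w_def column_def scaleR_conv_of_real[where 'a=complex])
  have "0 \<le> Y \<bullet> outer v" for v
  proof -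
    \<comment> \<open>This \<open>c\<close> makes coordinate \<open>i\<close> of
      \<open>M *v z\<close> vanish, so the cross terms drop out: the form at \<open>v\<close> is the
      form at \<open>z\<close> plus |c|^2 d, and the second summand is exactly what
      \<open>outer w\<close> removes.\<close>
    define c where "c = (M *v v) $ i / d"
    define z where "z = v - axis i c"
    have v: "v = z + axis i c"
      by (simp add: z_def)
    have Mz: "(M *v z) $ i = 0"
      using d by (simp add: z_def matrix_vector_mult_diff_distrib matrix_vector_axis c_def Mii)
    have "cdot w v = (\<Sum>j\<in>UNIV. M $ i $ j * v $ j) / sqrt d"
      by (simp add: cdot_def w_nth M_def mat_of_nth_cnj sum_divide_distrib)
    also have "\<dots> = c * sqrt d"
      using d by (simp add: c_def matrix_vector_mult_def field_simps flip: of_real_mult)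
    finally have ww: "outer w \<bullet> outer v = (cmod c)\<^sup>2 * d"
      using d by (simp add: inner_outer_outer norm_mult power_mult_distrib)
    have "X \<bullet> outer v = z \<bullet> (M *v z) + z \<bullet> (M *v axis i c) + axis i c \<bullet> (M *v z) + axis i c \<bullet> (M *v axis i c)"
      by (simp add: inner_outer M_def[symmetric] v matrix_vector_right_distrib inner_add_left inner_add_right)
    also have "z \<bullet> (M *v axis i c) = axis i c \<bullet> (M *v z)"
      by (rule hermitian_symmetric) (simp add: M_def hermitian_mat_of)
    also have "axis i c \<bullet> (M *v z) = 0"
      by (simp add: inner_axis' Mz)
    also have "axis i c \<bullet> (M *v axis i c) = (cmod c)\<^sup>2 * d"
      by (simp add: inner_axis' matrix_vector_axis Mii inner_complex_def cmod_power2)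
         (simp add: algebra_simps power2_eq_square)
    finally have "Y \<bullet> outer v = z \<bullet> (M *v z)"
      by (simp add: Y_def inner_diff_left ww)
    then show ?thesis
      using psd by (simp add: psd_def Re_cdot M_def)
  qed
  then have psdY: "psd (mat_of Y)"
    by (simp add: psd_iff)
  have Ydiag: "mat_of Y $ j $ j = M $ j $ j - w $ j * cnj (w $ j)" for j
    by (simp add: Y_def minus_herm.rep_eq mat_of_outer M_def)
  \<comment> \<open>A vanishing diagonal entry forces \<open>w $ j\<close> to be zero, so
    elimination creates no new nonzero diagonal entry while it clears entry
    \<open>i\<close>.\<close>
  have "M $ j $ i = 0" if "M $ j $ j = 0" for j
    using psd_zero_diag[OF psd, of j i] mat_of_nth_cnj[of X i j] that by (simp add: M_def)
  then have "mat_of Y $ j $ j = 0" if "M $ j $ j = 0" for j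
    using that by (simp add: Ydiag w_nth)
  moreover have "mat_of Y $ i $ i = 0"
    using d by (simp add: Ydiag w_nth Mii flip: of_real_mult of_real_divide)
  ultimately have "{j. mat_of Y $ j $ j \<noteq> 0} \<subset> {j. mat_of X $ j $ j \<noteq> 0}"
    using nz by (auto simp: M_def)
  then show ?thesis
    using psdY that[of Y w] by (simp add: Y_def)
qed

lemma psd_outer: "psd (mat_of (outer v))"
  by (simp add: psd_iff inner_outer_outer)

text \<open>Stands in for the spectral decomposition. Each Cholesky step lowers the number of
  nonzero diagonal entries, and a psd matrix with zero diagonal is zero.\<close>

lemma psd_imp_sum_outer:
  assumes "psd (mat_of X)"
  shows "\<exists>vs. X = sum_list (map outer vs)"
  using assms
proof (induction "card {j. mat_of X $ j $ j \<noteq> 0}" arbitrary: X rule: less_induct)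
  case less
  show ?case
  proof (cases "\<exists>i. mat_of X $ i $ i \<noteq> 0")
    case True
    then obtain i where "mat_of X $ i $ i \<noteq> 0" ..
    with less.prems obtain Y w where Y: "X = Y + outer w" "psd (mat_of Y)"
      "{j. mat_of Y $ j $ j \<noteq> 0} \<subset> {j. mat_of X $ j $ j \<noteq> 0}"
      using psd_cholesky_step by blast
    then obtain vs where "Y = sum_list (map outer vs)"
      using less.hyps[of Y] by (meson finite psubset_card_mono)
    with Y have "X = sum_list (map outer (w # vs))"
      by (simp add: add.commute)
    then show ?thesis ..
  next
    case False
    then have "mat_of X = 0"
      using psd_zero_diag[OF less.prems] by (simp add: vec_eq_iff)
    then have "X = sum_list (map outer [])"
      by (simp flip: mat_of_inject zero_herm.rep_eq)
    then show ?thesis ..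
  qed
qed

lemma inner_sum_outer: "sum_list (map outer vs) \<bullet> Y = (\<Sum>v\<leftarrow>vs. Y \<bullet> outer v)"
  by (induction vs) (simp_all add: inner_add_left inner_commute[of Y])

lemma psd_sum_outer: "psd (mat_of (sum_list (map outer vs)))"
  by (auto simp: psd_iff inner_sum_outer inner_outer_outer intro!: sum_list_nonneg)

section \<open>Pairings of psd matrices and complementary slackness\<close>

lemma psd_inner_nonneg:
  assumes "psd (mat_of X)" "psd (mat_of P)"
  shows "0 \<le> X \<bullet> P"
  using psd_imp_sum_outer[OF assms(1)] assms(2)
  by (auto simp: inner_sum_outer psd_iff intro!: sum_list_nonneg)

text \<open>The pairing is a sum of nonnegative values of the form of \<open>P\<close>; if it is
  zero, each value is zero, and \<open>psd_kernel\<close> applies to each vector.\<close>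

lemma psd_sum_outer_inner_zero:
  assumes "psd (mat_of P)" "sum_list (map outer vs) \<bullet> P = 0" "v \<in> set vs"
  shows "mat_of P *v v = 0"
proof -
  have "P \<bullet> outer v = 0"
    using assms by (subst (asm) inner_sum_outer, subst (asm) sum_list_nonneg_eq_0_iff) (auto simp: psd_iff)
  then show ?thesis
    using assms(1) by (simp add: inner_outer psd_kernel)
qed

text \<open>Triangle inequality over a rank-one decomposition, with equality of norm and trace on
  every term.\<close>

lemma norm_le_herm_trace:
  assumes "psd (mat_of X)"
  shows "norm X \<le> herm_trace X"
proof -
  obtain vs where X: "X = sum_list (map outer vs)"
    using psd_imp_sum_outer[OF assms] by blast
  have "norm (sum_list (map outer vs)) \<le> sum_list (map outer vs) \<bullet> id_herm"
  proof (induction vs)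
    case (Cons v vs)
    then show ?case
      using norm_triangle_ineq[of "outer v" "sum_list (map outer vs)"]
      by (simp add: inner_add_left trace_outer norm_outer)
  qed simp
  then show ?thesis
    by (simp add: X herm_trace_eq)
qed

subsection \<open>The largest eigenvalue\<close>

lemma mat_of_shift_mult:
  fixes H :: "'n::finite herm"
  shows "mat_of (c *\<^sub>R id_herm - H) *v v = c *\<^sub>R v - mat_of H *v v"
proof -
  have "(c *\<^sub>R (mat 1 :: complex^'n^'n)) *v v = c *\<^sub>R (mat 1 *v v)"
    by (simp add: vec_eq_iff matrix_vector_mult_def scaleR_sum_right)
  then show ?thesis
    by (simp add: minus_herm.rep_eq scaleR_herm.rep_eq mat_of_id_herm matrix_vector_mult_diff_rdistrib)
qed

lemma of_real_smult_vec: "complex_of_real c *s v = c *\<^sub>R v"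
  by (simp add: vec_eq_iff scaleR_conv_of_real[where 'a=complex])

lemma mem_eigenspace_shift:
  "v \<in> eigenspace (mat_of H) (complex_of_real c) \<longleftrightarrow> mat_of (c *\<^sub>R id_herm - H) *v v = 0"
  by (auto simp: eigenspace_def mat_of_shift_mult of_real_smult_vec)

text \<open>Makes the \<open>Max\<close> in \<open>lambda1\<close> meaningful. Eigenvectors chosen
  for distinct eigenvalues are orthogonal and nonzero, so the choice is injective with a finite
  image.\<close>

lemma finite_real_eigenvalues: "finite (real_eigenvalues (mat_of H))"
proof -
  define f where "f c = (SOME v. v \<noteq> 0 \<and> v \<in> eigenspace (mat_of H) (complex_of_real c))" for c
  have f: "f c \<noteq> 0" "mat_of H *v f c = c *\<^sub>R f c" if "c \<in> real_eigenvalues (mat_of H)" for c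
  proof -
    have "\<exists>v. v \<noteq> 0 \<and> v \<in> eigenspace (mat_of H) (complex_of_real c)"
      using that by (simp add: real_eigenvalues_def)
    from someI_ex[OF this] show "f c \<noteq> 0" "mat_of H *v f c = c *\<^sub>R f c"
      by (simp_all add: f_def eigenspace_def of_real_smult_vec)
  qed
  have orth: "f c \<bullet> f d = 0"
    if "c \<in> real_eigenvalues (mat_of H)" "d \<in> real_eigenvalues (mat_of H)" "c \<noteq> d" for c d
    using hermitian_symmetric[OF hermitian_mat_of, of "f c" H "f d"] f[OF that(1)] f[OF that(2)] that(3)
    by (simp add: inner_commute)
  have "inj_on f (real_eigenvalues (mat_of H))"
    using orth f(1) by (metis inj_onI inner_eq_zero_iff)
  moreover have "finite (f ` real_eigenvalues (mat_of H))"
    by (rule pairwise_orthogonal_imp_finite) (auto simp: pairwise_def orthogonal_def intro!: orth)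
  ultimately show ?thesis
    by (rule finite_imageD[rotated])
qed

text \<open>A maximizer of the Rayleigh quotient, with value \<open>\<mu>\<close>, is in the kernel of the
  positive semidefinite matrix \<open>\<mu>I - H\<close>, hence an eigenvector.\<close>

lemma lambda1_Rayleigh:
  fixes H :: "'n::finite herm"
  defines "l \<equiv> lambda1 (mat_of H)"
  shows "psd (mat_of (l *\<^sub>R id_herm - H))" "\<exists>v. norm v = 1 \<and> H \<bullet> outer v = l"
proof -
  define f where "f v = v \<bullet> (mat_of H *v v)" for v :: "complex^'n"
  have f: "H \<bullet> outer v = f v" for v
    by (simp add: f_def inner_outer)
  have "continuous_on (sphere 0 1) f"
    unfolding f_def by (intro continuous_intros)
  then obtain v0 where v0: "norm v0 = 1" "\<And>v. norm v = 1 \<Longrightarrow> f v \<le> f v0"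
    using continuous_attains_sup[of "sphere 0 1" f] by auto
  have shift: "(f v0 *\<^sub>R id_herm - H) \<bullet> outer v = f v0 * (v \<bullet> v) - f v" for v
    by (simp add: inner_diff_left f inner_commute[of id_herm] trace_outer)
  \<comment> \<open>The form is homogeneous of degree two, so the maximum over the unit sphere
    bounds it everywhere.\<close>
  have bound: "f v \<le> f v0 * (v \<bullet> v)" for v
  proof (cases "v = 0")
    case False
    define u where "u = (1 / norm v) *\<^sub>R v"
    have v: "v = norm v *\<^sub>R u"
      using False by (simp add: u_def)
    have "norm u = 1"
      using False by (simp add: u_def)
    then have "f u \<le> f v0"
      by (rule v0)
    moreover have "f v = (norm v)\<^sup>2 * f u"
      by (subst v) (simp add: f_def linear_cmul[OF matrix_vector_mul_linear] power2_eq_square)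
    ultimately show ?thesis
      by (simp add: power2_norm_eq_inner[symmetric] mult.commute mult_right_mono)
  qed (simp add: f_def)
  have psd: "psd (mat_of (f v0 *\<^sub>R id_herm - H))"
    by (simp add: psd_iff shift bound)
  have "mat_of (f v0 *\<^sub>R id_herm - H) *v v0 = 0"
    using psd_kernel[OF psd, of v0] shift[of v0] v0(1) by (simp add: inner_outer dot_square_norm)
  then have "v0 \<in> eigenspace (mat_of H) (complex_of_real (f v0))"
    by (simp add: mem_eigenspace_shift)
  then have "f v0 \<in> real_eigenvalues (mat_of H)"
    using v0(1) by (auto simp: real_eigenvalues_def intro!: exI[of _ v0])
  moreover have "c \<le> f v0" if c: "c \<in> real_eigenvalues (mat_of H)" for c
  proof -
    obtain v where v: "v \<noteq> 0" "mat_of H *v v = c *\<^sub>R v"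
      using c by (auto simp: real_eigenvalues_def eigenspace_def of_real_smult_vec)
    then have "c * (v \<bullet> v) \<le> f v0 * (v \<bullet> v)"
      using bound[of v] by (simp add: f_def)
    then show ?thesis
      using v(1) by simp
  qed
  ultimately have "l = f v0"
    unfolding l_def lambda1_def by (intro Max_eqI finite_real_eigenvalues)
  then show "psd (mat_of (l *\<^sub>R id_herm - H))" "\<exists>v. norm v = 1 \<and> H \<bullet> outer v = l"
    using psd v0(1) f by auto
qed

text \<open>Evaluate both forms at a unit vector that is maximal for the scaled matrix.\<close>

lemma lambda1_scaleR_le:
  assumes "0 \<le> t"
  shows "lambda1 (mat_of (t *\<^sub>R H)) \<le> t * lambda1 (mat_of H)"
proof -
  obtain v where v: "norm v = 1" "(t *\<^sub>R H) \<bullet> outer v = lambda1 (mat_of (t *\<^sub>R H))"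
    using lambda1_Rayleigh(2) by blast
  have "H \<bullet> outer v \<le> lambda1 (mat_of H)"
    using lambda1_Rayleigh(1)[of H] v(1)
    by (auto simp: psd_iff inner_diff_left inner_commute[of id_herm] trace_outer dot_square_norm
        dest!: spec[of _ v])
  then show ?thesis
    using v(2) mult_left_mono[OF _ assms] by fastforce
qed

lemma inner_le_lambda1_trace:
  assumes "psd (mat_of X)"
  shows "X \<bullet> H \<le> lambda1 (mat_of H) * herm_trace X"
  using psd_inner_nonneg[OF assms lambda1_Rayleigh(1)[of H]]
  by (simp add: inner_diff_right herm_trace_eq)

section \<open>Psd matrices of bounded trace\<close>

lemma compact_psd_trace_le: "compact {X. psd (mat_of X) \<and> herm_trace X \<le> p}"
proof -
  have "{X :: 'a herm. psd (mat_of X) \<and> herm_trace X \<le> p}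
      = (\<Inter>v. {X. outer v \<bullet> X \<ge> 0}) \<inter> {X. id_herm \<bullet> X \<le> p}"
    by (auto simp: psd_iff herm_trace_eq inner_commute)
  moreover have "closed \<dots>"
    by (intro closed_Int closed_INT ballI closed_halfspace_ge closed_halfspace_le)
  moreover have "bounded {X :: 'a herm. psd (mat_of X) \<and> herm_trace X \<le> p}"
    by (rule boundedI[of _ p]) (auto intro: order_trans[OF norm_le_herm_trace])
  ultimately show ?thesis
    by (simp add: compact_eq_bounded_closed)
qed

lemma convex_psd_trace_le: "convex {X. psd (mat_of X) \<and> herm_trace X \<le> p}"
proof -
  have "{X :: 'a herm. psd (mat_of X) \<and> herm_trace X \<le> p}
      = (\<Inter>v. {X. outer v \<bullet> X \<ge> 0}) \<inter> {X. id_herm \<bullet> X \<le> p}"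
    by (auto simp: psd_iff herm_trace_eq inner_commute)
  also have "convex \<dots>"
    by (intro convex_Int convex_INT convex_halfspace_ge convex_halfspace_le)
  finally show ?thesis .
qed

section \<open>Matrices of the form U S U*\<close>

lemma orthonormal_basis_of_range:
  assumes "orthonormal_basis_of U E"
  shows "E = range ((*v) U)"
proof -
  have "vec.span (columns U) \<subseteq> range ((*v) U)"
  proof (rule vec.span_minimal)
    have "column i U = U *v axis i 1" for i
      by (simp add: vec_eq_iff matrix_vector_axis column_def)
    then show "columns U \<subseteq> range ((*v) U)"
      by (auto simp: columns_def)
    show "vec.subspace (range ((*v) U))"
      using vec.subspace_image[OF vec.subspace_UNIV] .
  qed
  moreover have "range ((*v) U) \<subseteq> vec.span (columns U)"
    by (auto intro: matrix_vector_mult_in_columnspace_gen)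
  ultimately show ?thesis
    using assms by (auto simp: orthonormal_basis_of_def)
qed

lemma mat_of_outer_image: "mat_of (outer (U *v s)) = U ** mat_of (outer s) ** ctranspose U"
  by (simp add: vec_eq_iff mat_of_outer matrix_matrix_mult_def matrix_vector_mult_def ctranspose_def
      sum_product sum_distrib_left sum_distrib_right ac_simps)

lemma matrix_add_rdistrib: "(B + C) ** A = B ** A + C ** A"
  by (simp add: matrix_matrix_mult_def vec_eq_iff sum.distrib distrib_right)

text \<open>The dictionary between \<open>X\<close> and \<open>S\<close>: rank-one factors of
  \<open>X\<close> in the range of \<open>U\<close> correspond to rank-one factors of
  \<open>S\<close>. It is read in both directions in the final proof.\<close>

lemma mat_of_sum_outer_image:
  "mat_of (sum_list (map outer (map ((*v) U) ss)))
    = U ** mat_of (sum_list (map outer ss)) ** ctranspose U"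
  by (induction ss)
     (simp_all add: zero_herm.rep_eq plus_herm.rep_eq matrix_add_ldistrib matrix_add_rdistrib mat_of_outer_image)

subsection \<open>Dual norms\<close>

lemma is_norm_nonneg:
  assumes "is_norm N"
  shows "0 \<le> N x"
proof -
  have "N (x + (-1) *\<^sub>R x) \<le> N x + \<bar>-1\<bar> * N x"
    using assms unfolding is_norm_def by metis
  moreover have "N (x + (-1) *\<^sub>R x) = 0"
    using assms by (simp add: is_norm_def)
  ultimately show ?thesis
    by simp
qed

lemma is_norm_convex_on:
  assumes "is_norm N"
  shows "convex_on UNIV N"
  unfolding convex_on_def
proof (intro conjI convex_UNIV ballI allI impI)
  fix x y and u v :: real
  assume "0 \<le> u" "0 \<le> v"
  then have "N (u *\<^sub>R x) = u * N x" "N (v *\<^sub>R y) = v * N y"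
    using assms by (simp_all add: is_norm_def)
  then show "N (u *\<^sub>R x + v *\<^sub>R y) \<le> u * N x + v * N y"
    using assms unfolding is_norm_def by metis
qed

text \<open>\<open>N\<close> is an arbitrary norm, not the one of the type class; its continuity
  comes from convexity in finite dimension.\<close>

lemma is_norm_continuous:
  fixes N :: "'a::euclidean_space \<Rightarrow> real"
  assumes "is_norm N"
  shows "continuous_on UNIV N"
  using convex_on_continuous[OF open_UNIV is_norm_convex_on[OF assms]] .

lemma is_norm_convex_ball:
  assumes "is_norm N"
  shows "convex {z. N z \<le> r}"
proof (rule convexI)
  fix x y and u v :: real
  assume xy: "x \<in> {z. N z \<le> r}" "y \<in> {z. N z \<le> r}" and uv: "0 \<le> u" "0 \<le> v" "u + v = 1"
  have "N (u *\<^sub>R x + v *\<^sub>R y) \<le> u * N x + v * N y"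
    using is_norm_convex_on[OF assms] uv by (simp add: convex_on_def)
  also have "\<dots> \<le> r"
    using xy uv by (intro convex_bound_le) simp_all
  finally show "u *\<^sub>R x + v *\<^sub>R y \<in> {z. N z \<le> r}"
    by simp
qed

text \<open>Closed by continuity. Bounded because \<open>N\<close> has a positive minimum on the
  Euclidean unit sphere, which gives norm z <= r / N u by homogeneity.\<close>

lemma is_norm_compact_ball:
  fixes N :: "'a::euclidean_space \<Rightarrow> real"
  assumes N: "is_norm N"
  shows "compact {z. N z \<le> r}"
proof -
  have "closed {z. N z \<le> r}"
    using is_norm_continuous[OF N] by (intro closed_Collect_le continuous_on_const)
  moreover have "bounded {z. N z \<le> r}"
  proof -
    have "continuous_on (sphere 0 1) N"
      using is_norm_continuous[OF N] by (rule continuous_on_subset) simp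
    then obtain u where u: "norm u = 1" "\<And>v. norm v = 1 \<Longrightarrow> N u \<le> N v"
      using continuous_attains_inf[of "sphere 0 1" N] by auto
    have "0 < N u"
      using u(1) is_norm_nonneg[OF N, of u] N by (auto simp: is_norm_def less_le)
    have "norm z \<le> r / N u" if "N z \<le> r" for z
    proof (cases "z = 0")
      case True
      then show ?thesis
        using that is_norm_nonneg[OF N, of z] \<open>0 < N u\<close> by simp
    next
      case False
      have "N u \<le> N ((1 / norm z) *\<^sub>R z)"
        using False by (intro u) simp
      also have "\<dots> = N z / norm z"
        using N by (simp add: is_norm_def)
      finally have "norm z * N u \<le> N z"
        using False by (simp add: field_simps)
      with that show ?thesis
        using \<open>0 < N u\<close> by (simp add: field_simps)
    qed
    then show ?thesis
      by (auto simp: bounded_iff)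
  qed
  ultimately show ?thesis
    by (simp add: compact_eq_bounded_closed)
qed

lemma dual_norm_attained:
  fixes N :: "'a::euclidean_space \<Rightarrow> real"
  assumes N: "is_norm N"
  shows "\<exists>z. N z \<le> 1 \<and> z \<bullet> y = dual_norm N y \<and> (\<forall>w. N w \<le> 1 \<longrightarrow> w \<bullet> y \<le> z \<bullet> y)"
proof -
  have "N 0 = 0"
    using N by (simp add: is_norm_def)
  then have "{z. N z \<le> 1} \<noteq> {}"
    by (auto intro!: exI[of _ 0])
  then obtain z where z: "N z \<le> 1" "\<And>w. N w \<le> 1 \<Longrightarrow> w \<bullet> y \<le> z \<bullet> y"
    using continuous_attains_sup[OF is_norm_compact_ball[OF N, of 1], of "\<lambda>w. w \<bullet> y"]
    by (force intro: continuous_intros)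
  have "dual_norm N y = z \<bullet> y"
    unfolding dual_norm_def using z by (intro cSup_eq_maximum) auto
  with z show ?thesis
    by auto
qed

lemma inner_le_dual_norm:
  fixes N :: "'a::euclidean_space \<Rightarrow> real"
  assumes "is_norm N" "N z \<le> 1"
  shows "z \<bullet> y \<le> dual_norm N y"
  using dual_norm_attained[OF assms(1), of y] assms(2) by auto

text \<open>Rescale \<open>x\<close> by 1/e into the unit ball. For e = 0 the bound forces x = 0
  instead.\<close>

lemma inner_le_mult_dual_norm:
  fixes N :: "'a::euclidean_space \<Rightarrow> real"
  assumes N: "is_norm N" and "N x \<le> e"
  shows "x \<bullet> y \<le> e * dual_norm N y"
proof (cases "e = 0")
  case True
  then have "x = 0"
    using assms is_norm_nonneg[OF N, of x] by (auto simp: is_norm_def)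
  with True show ?thesis
    by simp
next
  case False
  then have "0 < e"
    using assms(2) is_norm_nonneg[OF N, of x] by simp
  then have "((1 / e) *\<^sub>R x) \<bullet> y \<le> dual_norm N y"
    using assms by (intro inner_le_dual_norm) (simp_all add: is_norm_def)
  then show ?thesis
    using \<open>0 < e\<close> by (simp add: field_simps)
qed

lemma dual_norm_scaleR:
  fixes N :: "'a::euclidean_space \<Rightarrow> real"
  assumes N: "is_norm N" and "0 \<le> t"
  shows "dual_norm N (t *\<^sub>R y) = t * dual_norm N y"
proof (rule antisym)
  obtain z where z: "N z \<le> 1" "z \<bullet> (t *\<^sub>R y) = dual_norm N (t *\<^sub>R y)"
    using dual_norm_attained[OF N] by blast
  have "dual_norm N (t *\<^sub>R y) = t * (z \<bullet> y)"
    using z(2) by simp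
  also have "\<dots> \<le> t * dual_norm N y"
    using inner_le_dual_norm[OF N z(1)] assms(2) by (rule mult_left_mono)
  finally show "dual_norm N (t *\<^sub>R y) \<le> t * dual_norm N y" .
next
  obtain z where z: "N z \<le> 1" "z \<bullet> y = dual_norm N y"
    using dual_norm_attained[OF N] by blast
  then show "t * dual_norm N y \<le> dual_norm N (t *\<^sub>R y)"
    using inner_le_dual_norm[OF N z(1), of "t *\<^sub>R y"] by simp
qed

section \<open>The subdifferential of the dual norm\<close>

text \<open>The inequality \<open>N z \<le> 1\<close> is the bidual norm identity, by separating \<open>z\<close> from the unit ball.\<close>

lemma mem_subdifferential_dual_norm_iff:
  fixes N :: "'a::euclidean_space \<Rightarrow> real"
  assumes N: "is_norm N"
  shows "z \<in> subdifferential (dual_norm N) y \<longleftrightarrow> N z \<le> 1 \<and> z \<bullet> y = dual_norm N y"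
proof (intro iffI conjI)
  assume "z \<in> subdifferential (dual_norm N) y"
  then have sub: "dual_norm N y + z \<bullet> (w - y) \<le> dual_norm N w" for w
    by (simp add: subdifferential_def)
  show eq: "z \<bullet> y = dual_norm N y"
    \<comment> \<open>The subgradient inequality at the points 0 and 2y of the ray through
      \<open>y\<close> gives the two opposite inequalities. Both points are written as multiples of
      \<open>y\<close> so that homogeneity rewrites them.\<close>
    using sub[of "0 *\<^sub>R y"] sub[of "2 *\<^sub>R y"]
    by (simp only: dual_norm_scaleR[OF N]) (simp add: inner_diff_right)
  have le: "z \<bullet> w \<le> dual_norm N w" for w
    using sub[of w] eq by (simp add: inner_diff_right)
  show "N z \<le> 1"
  proof (rule ccontr)
    assume "\<not> N z \<le> 1"
    then have "z \<notin> {z. N z \<le> 1}"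
      by simp
    then obtain a c where ac: "a \<bullet> z < c" "\<And>x. N x \<le> 1 \<Longrightarrow> c < a \<bullet> x"
      using separating_hyperplane_closed_point[OF is_norm_convex_ball[OF N]
          compact_imp_closed[OF is_norm_compact_ball[OF N]]] by blast
    \<comment> \<open>This \<open>x\<close> minimizes the inner product with \<open>a\<close> over
      the ball; \<open>le\<close> at \<open>- a\<close> then gives a.x <= a.z < c, against the
      separation.\<close>
    obtain x where x: "N x \<le> 1" "x \<bullet> (- a) = dual_norm N (- a)"
      using dual_norm_attained[OF N] by blast
    show False
      using ac(1) ac(2)[OF x(1)] x(2) le[of "- a"] by (simp add: inner_commute)
  qed
next
  assume z: "N z \<le> 1 \<and> z \<bullet> y = dual_norm N y"
  then show "z \<in> subdifferential (dual_norm N) y"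
    using inner_le_dual_norm[OF N] by (simp add: subdifferential_def inner_diff_right)
qed

lemma mem_scaled_subdifferential_dual_norm_iff:
  fixes N :: "'a::euclidean_space \<Rightarrow> real"
  assumes N: "is_norm N" and "0 \<le> e"
  shows "x \<in> (\<lambda>z. e *\<^sub>R z) ` subdifferential (dual_norm N) y
    \<longleftrightarrow> N x \<le> e \<and> x \<bullet> y = e * dual_norm N y"
proof
  assume "x \<in> (\<lambda>z. e *\<^sub>R z) ` subdifferential (dual_norm N) y"
  then obtain z where z: "N z \<le> 1" "z \<bullet> y = dual_norm N y" "x = e *\<^sub>R z"
    by (auto simp: mem_subdifferential_dual_norm_iff[OF N])
  then have "N x = e * N z"
    using assms by (simp add: is_norm_def)
  then show "N x \<le> e \<and> x \<bullet> y = e * dual_norm N y"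
    using z assms(2) by (simp add: mult_left_le)
next
  assume x: "N x \<le> e \<and> x \<bullet> y = e * dual_norm N y"
  show "x \<in> (\<lambda>z. e *\<^sub>R z) ` subdifferential (dual_norm N) y"
  proof (cases "e = 0")
    case True
    then have "x = 0"
      using x is_norm_nonneg[OF N, of x] N by (auto simp: is_norm_def)
    \<comment> \<open>For e = 0 the scaled set is {0} only if the subdifferential is nonempty; a
      maximizer in the dual norm is an element.\<close>
    obtain z where "z \<in> subdifferential (dual_norm N) y"
      using dual_norm_attained[OF N, of y] mem_subdifferential_dual_norm_iff[OF N] by blast
    then show ?thesis
      using True \<open>x = 0\<close> by (intro image_eqI[of _ _ z]) simp_all
  next
    case False
    then have "N ((1 / e) *\<^sub>R x) \<le> 1"
      using x N assms(2) by (simp add: is_norm_def)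
    then show ?thesis
      using False x by (intro image_eqI[of _ _ "(1 / e) *\<^sub>R x"])
        (simp_all add: mem_subdifferential_dual_norm_iff[OF N])
  qed
qed

subsection \<open>Gauge duality\<close>

text \<open>The two inequalities are kept apart because tightness of the first yields the
  subgradient condition and tightness of the second the form of \<open>X\<close>.\<close>

lemma weak_gauge_duality:
  fixes A :: "'n::finite herm \<Rightarrow> 'm::euclidean_space"
  assumes "linear A" "is_norm N" "psd (mat_of X)" "N (b - A X) \<le> e"
  shows "b \<bullet> y - e * dual_norm N y \<le> X \<bullet> adjoint A y"
    and "X \<bullet> adjoint A y \<le> lambda1 (mat_of (adjoint A y)) * herm_trace X"
proof -
  show "b \<bullet> y - e * dual_norm N y \<le> X \<bullet> adjoint A y"
    using inner_le_mult_dual_norm[OF assms(2,4), of y]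
    by (simp add: adjoint_works[OF assms(1)] inner_diff_left)
  show "X \<bullet> adjoint A y \<le> lambda1 (mat_of (adjoint A y)) * herm_trace X"
    using inner_le_lambda1_trace[OF assms(3)] .
qed

text \<open>Infeasibility at trace level \<open>p\<close> puts \<open>b\<close> outside a compact
  convex set. The support function of that set at the separating \<open>y\<close> is the trace part
  p max(0, lambda_1) plus the ball part e times the dual norm.\<close>

lemma gauge_dual_separation:
  fixes A :: "'n::finite herm \<Rightarrow> 'm::euclidean_space"
  assumes A: "linear A" and N: "is_norm N" and e: "0 \<le> e" and p: "0 \<le> p"
    and infeasible: "\<And>X. psd (mat_of X) \<Longrightarrow> N (b - A X) \<le> e \<Longrightarrow> p < herm_trace X"
  shows "\<exists>y. p * max 0 (lambda1 (mat_of (adjoint A y))) < b \<bullet> y - e * dual_norm N y"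
proof -
  define C where "C = {X :: 'n herm. psd (mat_of X) \<and> herm_trace X \<le> p}"
  define K where "K = (\<Union>x\<in>A ` C. \<Union>z\<in>{z. N z \<le> e}. {x + z})"
  have "continuous_on C A"
    using A by (simp add: linear_continuous_on linear_conv_bounded_linear)
  then have "compact (A ` C)"
    unfolding C_def by (intro compact_continuous_image compact_psd_trace_le)
  then have "closed K"
    unfolding K_def by (intro compact_imp_closed compact_sums' is_norm_compact_ball[OF N])
  moreover have "convex K"
    unfolding K_def
    by (intro convex_sums is_norm_convex_ball[OF N] convex_linear_image[OF A])
       (simp add: C_def convex_psd_trace_le)
  moreover have "b \<notin> K"
  proof
    assume "b \<in> K"
    then obtain X z where "X \<in> C" "N z \<le> e" "b = A X + z"
      by (auto simp: K_def)
    then show False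
      using infeasible[of X] by (simp add: C_def)
  qed
  ultimately obtain a c where a: "a \<bullet> b < c" "\<And>x. x \<in> K \<Longrightarrow> c < a \<bullet> x"
    using separating_hyperplane_closed_point by metis
  \<comment> \<open>The sign is reversed so that \<open>b\<close> has the larger inner
    product.\<close>
  define y where "y = - a"
  have K: "x \<bullet> y < b \<bullet> y" if "x \<in> K" for x
    using a(1) a(2)[OF that] by (simp add: y_def inner_commute)
  obtain z where z: "N z \<le> 1" "z \<bullet> y = dual_norm N y"
    using dual_norm_attained[OF N] by blast
  have ez: "N (e *\<^sub>R z) \<le> e"
    using N e z(1) by (simp add: is_norm_def mult_left_le)
  have X: "X \<bullet> adjoint A y < b \<bullet> y - e * dual_norm N y" if "X \<in> C" for X
  proof -
    have "A X + e *\<^sub>R z \<in> K"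
      using that ez by (auto simp: K_def)
    from K[OF this] show ?thesis
      by (simp add: adjoint_works[OF A] inner_add_left z(2))
  qed
  obtain v where v: "norm v = 1" "adjoint A y \<bullet> outer v = lambda1 (mat_of (adjoint A y))"
    using lambda1_Rayleigh(2) by blast
  \<comment> \<open>The matrices p v v* and 0 realize the two arguments of the maximum.\<close>
  have "p *\<^sub>R outer v \<in> C"
    using p v(1) psd_outer[of v]
    by (simp add: C_def psd_iff herm_trace_eq trace_outer dot_square_norm)
  moreover have "0 \<in> C"
    using p by (simp add: C_def psd_iff herm_trace_eq)
  ultimately have "p * lambda1 (mat_of (adjoint A y)) < b \<bullet> y - e * dual_norm N y"
    "0 < b \<bullet> y - e * dual_norm N y"
    using X[of "p *\<^sub>R outer v"] X[of 0] v(2) by (simp_all add: inner_commute)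
  then show ?thesis
    by (intro exI[of _ y]) (simp add: max_def)
qed

text \<open>If l p > 1, no feasible psd matrix has trace at most some \<open>q\<close> strictly
  between 1/l and \<open>p\<close>. Separation at level \<open>q\<close>, after rescaling, gives a
  dual feasible point of value below 1/q < l, against optimality.\<close>

lemma strong_gauge_duality:
  fixes A :: "'n::finite herm \<Rightarrow> 'm::euclidean_space"
  assumes A: "linear A" and N: "is_norm N" and e: "0 \<le> e"
    and opt: "is_arg_min (\<lambda>y. max 0 (lambda1 (mat_of (adjoint A y))))
           (\<lambda>y. b \<bullet> y - e * dual_norm N y \<ge> 1) y"
    and pos: "0 < lambda1 (mat_of (adjoint A y))"
    and min: "\<And>X. psd (mat_of X) \<Longrightarrow> N (b - A X) \<le> e \<Longrightarrow> p \<le> herm_trace X"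
  shows "lambda1 (mat_of (adjoint A y)) * p \<le> 1"
proof (rule ccontr)
  define l where "l = lambda1 (mat_of (adjoint A y))"
  assume "\<not> ?thesis"
  then have "1 / l < p"
    using pos by (simp add: l_def field_simps)
  then obtain q where q: "1 / l < q" "q < p"
    using dense by blast
  have "0 < q"
    using q(1) pos by (intro less_trans[OF _ q(1)]) (simp add: l_def)
  have "\<exists>y. q * max 0 (lambda1 (mat_of (adjoint A y))) < b \<bullet> y - e * dual_norm N y"
    using \<open>0 < q\<close> q(2) min by (intro gauge_dual_separation[OF A N e]) force+
  then obtain a where a: "q * max 0 (lambda1 (mat_of (adjoint A a))) < b \<bullet> a - e * dual_norm N a" ..
  define t where "t = b \<bullet> a - e * dual_norm N a"
  have "0 \<le> q * max 0 (lambda1 (mat_of (adjoint A a)))"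
    using \<open>0 < q\<close> by simp
  then have t: "0 < t"
    using a by (simp add: t_def)
  \<comment> \<open>The dual constraint function is positively homogeneous, so dividing by its value
    \<open>t\<close> at \<open>a\<close> makes it equal to 1.\<close>
  define w where "w = (1 / t) *\<^sub>R a"
  have "dual_norm N w = dual_norm N a / t"
    using t dual_norm_scaleR[OF N, of "1 / t" a] by (simp add: w_def)
  then have "b \<bullet> w - e * dual_norm N w = (b \<bullet> a - e * dual_norm N a) / t"
    by (simp add: w_def diff_divide_distrib)
  then have "b \<bullet> w - e * dual_norm N w \<ge> 1"
    using t by (simp add: t_def)
  then have "max 0 l \<le> max 0 (lambda1 (mat_of (adjoint A w)))"
    using opt by (force simp: is_arg_min_def l_def)
  then have "l \<le> max 0 (lambda1 (mat_of (adjoint A w)))"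
    by simp
  also have "adjoint A w = (1 / t) *\<^sub>R adjoint A a"
    by (simp add: w_def linear_cmul[OF adjoint_linear[OF A]])
  also have "max 0 (lambda1 (mat_of ((1 / t) *\<^sub>R adjoint A a))) \<le> max 0 (lambda1 (mat_of (adjoint A a))) / t"
  proof -
    have "lambda1 (mat_of ((1 / t) *\<^sub>R adjoint A a)) \<le> lambda1 (mat_of (adjoint A a)) / t"
      using lambda1_scaleR_le[of "1 / t" "adjoint A a"] t by simp
    also have "\<dots> \<le> max 0 (lambda1 (mat_of (adjoint A a))) / t"
      using t by (simp add: divide_right_mono)
    finally show ?thesis
      using t by simp
  qed
  finally have "l * t \<le> max 0 (lambda1 (mat_of (adjoint A a)))"
    using t by (simp add: field_simps)
  then have "q * (l * t) \<le> q * max 0 (lambda1 (mat_of (adjoint A a)))"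
    using \<open>0 < q\<close> by simp
  also have "\<dots> < t"
    using a by (simp add: t_def)
  finally have "q * l < 1"
    using t by simp
  then show False
    using q(1) pos by (simp add: l_def field_simps)
qed

text \<open>The feasible psd point has a finite value and so beats every matrix outside the cone;
  what remains is a comparison of real traces.\<close>

lemma is_arg_min_psd_trace:
  assumes "\<exists>X. psd (mat_of X) \<and> P X"
  shows "is_arg_min (\<lambda>X. ereal (herm_trace X) + psd_indicator X) P X
    \<longleftrightarrow> psd (mat_of X) \<and> P X \<and> (\<forall>X'. psd (mat_of X') \<longrightarrow> P X' \<longrightarrow> herm_trace X \<le> herm_trace X')"
proof -
  define f where "f X = ereal (herm_trace X) + psd_indicator X" for X :: "'a herm"
  have f: "f X = (if psd (mat_of X) then ereal (herm_trace X) else \<infinity>)" for X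
    by (simp add: f_def psd_indicator_def)
  obtain X0 where X0: "psd (mat_of X0)" "P X0"
    using assms by blast
  have "is_arg_min f P X
    \<longleftrightarrow> psd (mat_of X) \<and> P X \<and> (\<forall>X'. psd (mat_of X') \<longrightarrow> P X' \<longrightarrow> herm_trace X \<le> herm_trace X')"
  proof (cases "psd (mat_of X)")
    case True
    then show ?thesis
      by (auto simp: is_arg_min_def f not_less)
  next
    case False
    then have "f X0 < f X"
      using X0 by (simp add: f)
    then show ?thesis
      using False X0 by (auto simp: is_arg_min_def)
  qed
  then show ?thesis
    by (simp add: f_def[abs_def])
qed

section \<open>Characterization of the primal solutions\<close>

theorem corollary3p3:
  fixes A :: "'n::finite herm \<Rightarrow> real^'m::finite"
    and b y :: "real^'m"
    and N :: "real^'m \<Rightarrow> real"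
    and \<epsilon> :: real
    and U1 :: "complex^'r::finite^'n"
    and X :: "'n herm"
  assumes "linear A"
    and "is_norm N"
    and "0 \<le> \<epsilon>" and "\<epsilon> < N b"
    and "\<exists>X. psd (mat_of X) \<and> N (b - A X) \<le> \<epsilon>"
    and "is_arg_min (\<lambda>y. max 0 (lambda1 (mat_of (adjoint A y))))
           (\<lambda>y. b \<bullet> y - \<epsilon> * dual_norm N y \<ge> 1) y"
    and "CARD('r) = eig_multiplicity (mat_of (adjoint A y)) (lambda1 (mat_of (adjoint A y)))"
    and "orthonormal_basis_of U1
           (eigenspace (mat_of (adjoint A y)) (complex_of_real (lambda1 (mat_of (adjoint A y)))))"
  shows "is_arg_min (\<lambda>X. ereal (herm_trace X) + psd_indicator X) (\<lambda>X. N (b - A X) \<le> \<epsilon>) X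
     \<longleftrightarrow> (\<exists>S :: complex^'r^'r. psd S \<and>
            mat_of X = U1 ** S ** ctranspose U1 \<and>
            b - A X \<in> (\<lambda>z. \<epsilon> *\<^sub>R z) ` subdifferential (dual_norm N) y)"
proof -
  note A = assms(1) and N = assms(2) and eps = assms(3) and opt = assms(6)
  define H where "H = adjoint A y"
  define l where "l = lambda1 (mat_of H)"
  \<comment> \<open>The dual slack matrix: its kernel is the eigenspace, and its pairing with
    \<open>Z\<close> is the gap in the second weak duality inequality.\<close>
  define P where "P = l *\<^sub>R id_herm - H"
  define D where "D = \<epsilon> * dual_norm N y"
  have P: "psd (mat_of P)"
    unfolding P_def l_def by (rule lambda1_Rayleigh)
  have inner_P: "Z \<bullet> P = l * herm_trace Z - Z \<bullet> H" for Z
    by (simp add: P_def inner_diff_right herm_trace_eq)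
  have kernel: "mat_of P *v v = 0 \<longleftrightarrow> v \<in> range ((*v) U1)" for v
    using orthonormal_basis_of_range[OF assms(8)] mem_eigenspace_shift[of v H l]
    by (simp add: P_def H_def l_def)
  have feasible: "1 \<le> b \<bullet> y - D"
    using opt by (simp add: is_arg_min_def D_def)
  have weak: "b \<bullet> y - D \<le> Z \<bullet> H" "Z \<bullet> H \<le> l * herm_trace Z"
    if "psd (mat_of Z)" "N (b - A Z) \<le> \<epsilon>" for Z
    using weak_gauge_duality[OF A N that] by (simp_all add: D_def H_def l_def)
  have residual: "(b - A X) \<bullet> y = b \<bullet> y - X \<bullet> H"
    by (simp add: H_def adjoint_works[OF A] inner_diff_left)
  \<comment> \<open>A primal feasible \<open>Z\<close> gives 1 <= l tr Z with tr Z >= 0. Positivity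
    allows \<open>l\<close> to be cancelled later.\<close>
  have l_pos: "0 < l"
  proof -
    obtain Z where Z: "psd (mat_of Z)" "N (b - A Z) \<le> \<epsilon>"
      using assms(5) by blast
    have "0 < l * herm_trace Z"
      using weak[OF Z] feasible by simp
    moreover have "0 \<le> herm_trace Z"
      using norm_le_herm_trace[OF Z(1)] norm_ge_zero by (rule order_trans[rotated])
    ultimately show ?thesis
      by (simp add: zero_less_mult_iff)
  qed
  have mem: "b - A X \<in> (\<lambda>z. \<epsilon> *\<^sub>R z) ` subdifferential (dual_norm N) y
      \<longleftrightarrow> N (b - A X) \<le> \<epsilon> \<and> b \<bullet> y - X \<bullet> H = D"
    by (simp add: mem_scaled_subdifferential_dual_norm_iff[OF N eps] residual D_def)
  show ?thesis
    unfolding is_arg_min_psd_trace[OF assms(5)] mem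
  proof (intro iffI)
    assume *: "psd (mat_of X) \<and> N (b - A X) \<le> \<epsilon> \<and>
      (\<forall>X'. psd (mat_of X') \<longrightarrow> N (b - A X') \<le> \<epsilon> \<longrightarrow> herm_trace X \<le> herm_trace X')"
    \<comment> \<open>Optimality makes tr X the lower bound \<open>p\<close> of
      \<open>strong_gauge_duality\<close>.\<close>
    have "l * herm_trace X \<le> 1"
      unfolding l_def H_def using * l_pos
      by (intro strong_gauge_duality[OF A N eps opt]) (simp_all add: l_def H_def)
    \<comment> \<open>The chain 1 <= b.y - D <= X.H <= l tr X <= 1 collapses to equalities.\<close>
    then have eq: "b \<bullet> y - X \<bullet> H = D" "X \<bullet> P = 0"
      using weak[of X] * feasible by (simp_all add: inner_P)
    obtain vs where X: "X = sum_list (map outer vs)"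
      using psd_imp_sum_outer * by blast
    have "\<forall>v\<in>set vs. v \<in> range ((*v) U1)"
      using psd_sum_outer_inner_zero[OF P] eq(2) by (simp add: X kernel)
    \<comment> \<open>Preimages of the factors under \<open>U1\<close>; their rank-one matrices add
      up to \<open>S\<close>.\<close>
    then obtain ss where ss: "vs = map ((*v) U1) ss"
      by (metis ex_map_conv rangeE)
    have "mat_of X = U1 ** mat_of (sum_list (map outer ss)) ** ctranspose U1"
      unfolding X ss by (rule mat_of_sum_outer_image)
    then show "\<exists>S :: complex^'r^'r. psd S \<and> mat_of X = U1 ** S ** ctranspose U1 \<and>
        N (b - A X) \<le> \<epsilon> \<and> b \<bullet> y - X \<bullet> H = D"
      using * eq(1) psd_sum_outer by blast
  next
    assume "\<exists>S :: complex^'r^'r. psd S \<and> mat_of X = U1 ** S ** ctranspose U1 \<and>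
        N (b - A X) \<le> \<epsilon> \<and> b \<bullet> y - X \<bullet> H = D"
    then obtain S :: "complex^'r^'r" where S: "psd S" "mat_of X = U1 ** S ** ctranspose U1"
      and X: "N (b - A X) \<le> \<epsilon>" "b \<bullet> y - X \<bullet> H = D"
      by blast
    have "mat_of (Herm S) = S"
      using S(1) by (intro Herm_inverse) (simp add: psd_def)
    moreover from this obtain ss where "Herm S = sum_list (map outer ss)"
      using psd_imp_sum_outer[of "Herm S"] S(1) by auto
    ultimately have "mat_of (sum_list (map outer ss)) = S"
      by simp
    then have "mat_of X = mat_of (sum_list (map outer (map ((*v) U1) ss)))"
      unfolding mat_of_sum_outer_image S(2) by simp
    then have X_eq: "X = sum_list (map outer (map ((*v) U1) ss))"
      by (simp only: mat_of_inject)
    have psd_X: "psd (mat_of X)"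
      unfolding X_eq by (rule psd_sum_outer)
    have "mat_of P *v (U1 *v s) = 0" for s
      using kernel by blast
    then have "X \<bullet> P = 0"
      unfolding X_eq inner_sum_outer inner_outer by (simp add: o_def)
    then have "l * herm_trace X = b \<bullet> y - D"
      using X(2) by (simp add: inner_P)
    \<comment> \<open>Weak duality bounds l tr Z below by the same number b.y - D that
      \<open>X\<close> attains.\<close>
    then have "l * herm_trace X \<le> l * herm_trace Z" if "psd (mat_of Z)" "N (b - A Z) \<le> \<epsilon>" for Z
      using weak[OF that] by simp
    then show "psd (mat_of X) \<and> N (b - A X) \<le> \<epsilon> \<and>
      (\<forall>X'. psd (mat_of X') \<longrightarrow> N (b - A X') \<le> \<epsilon> \<longrightarrow> herm_trace X \<le> herm_trace X')"
      using psd_X X(1) l_pos by simp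
  qed
qed

end
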